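(* Let $(S,+,\circ)$ be a weak brace, and for $a\in S$ let $\lambda_a:S\to S$, $\lambda_a(b)=a\circ(a^-+b)$. Then $\lambda_a$ is an endomorphism of $(S,+)$, for every $a\in S$. Moreover, the map $\lambda:S\to\mathrm{End}(S,+)$, $a\mapsto\lambda_a$, is a homomorphism of the inverse semigroup $(S,\circ)$ into the endomorphism semigroup of $(S,+)$, i.e. $\lambda_{a\circ b}=\lambda_a\lambda_b$ for all $a,b\in S$.
   Context: A semigroup is inverse if each element $a$ has a unique inverse, i.e. a unique $x$ with $axa=a$ and $xax=x$. A weak (left) brace is a non-empty set $S$ with two binary operations $+$ and $\circ$ such that $(S,+)$ and $(S,\circ)$ are both inverse semigroups (not necessarily commutative) and, for all $a,b,c\in S$, $a\circ(b+c)=a\circ b-a+a\circ c$ and $a\circ a^-=-a+a$, where $-a$ is the inverse of $a$ in $(S,+)$, $a^-$ is the inverse of $a$ in $(S,\circ)$, and $\circ$ has higher precedence than $+$. In a weak brace $a\circ(a^-+b)=-a+a\circ b$. Juxtaposition of maps is composition, $(\lambda_a\lambda_b)(c)=\lambda_a(\lambda_b(c))$. *)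

theory Defs
  imports "HOL-Library.FuncSet"
begin

locale semigroup_on =
  fixes S :: "'a set" and f :: "'a \<Rightarrow> 'a \<Rightarrow> 'a"
  assumes closed: "a \<in> S \<Longrightarrow> b \<in> S \<Longrightarrow> f a b \<in> S"
    and assoc: "a \<in> S \<Longrightarrow> b \<in> S \<Longrightarrow> c \<in> S \<Longrightarrow> f (f a b) c = f a (f b c)"

definition is_inverse_on :: "'a set \<Rightarrow> ('a \<Rightarrow> 'a \<Rightarrow> 'a) \<Rightarrow> 'a \<Rightarrow> 'a \<Rightarrow> bool" where
  "is_inverse_on S f a x \<longleftrightarrow> x \<in> S \<and> f (f a x) a = a \<and> f (f x a) x = x"

locale inverse_semigroup_on = semigroup_on +
  assumes ex1_inverse: "a \<in> S \<Longrightarrow> \<exists>!x. is_inverse_on S f a x"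

definition inverse_on :: "'a set \<Rightarrow> ('a \<Rightarrow> 'a \<Rightarrow> 'a) \<Rightarrow> 'a \<Rightarrow> 'a" where
  "inverse_on S f a = (THE x. is_inverse_on S f a x)"

locale semigroup_hom_on = source: semigroup_on S f + target: semigroup_on T g
  for S :: "'a set" and f :: "'a \<Rightarrow> 'a \<Rightarrow> 'a"
    and T :: "'b set" and g :: "'b \<Rightarrow> 'b \<Rightarrow> 'b" +
  fixes h :: "'a \<Rightarrow> 'b"
  assumes maps_to: "h \<in> S \<rightarrow> T"
    and hom: "a \<in> S \<Longrightarrow> b \<in> S \<Longrightarrow> h (f a b) = g (h a) (h b)"

text \<open>
  Maps \<open>S \<rightarrow> S\<close> are represented extensionally (they are \<open>undefined\<close> outside \<open>S\<close>), so that
  equality of HOL functions is equality of maps on \<open>S\<close>. Composition is then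
  \<^const>\<open>compose\<close>\<open> S\<close>, where \<open>compose S h k c = h (k c)\<close> for \<open>c \<in> S\<close>.
\<close>

definition endomorphisms_on :: "'a set \<Rightarrow> ('a \<Rightarrow> 'a \<Rightarrow> 'a) \<Rightarrow> ('a \<Rightarrow> 'a) set" where
  "endomorphisms_on S f = {h \<in> S \<rightarrow>\<^sub>E S. semigroup_hom_on S f S f h}"

locale weak_brace =
  add: inverse_semigroup_on S add + circ: inverse_semigroup_on S circ
  for S :: "'a set"
    and add :: "'a \<Rightarrow> 'a \<Rightarrow> 'a" (infixl "\<oplus>" 65)
    and circ :: "'a \<Rightarrow> 'a \<Rightarrow> 'a" (infixl "\<odot>" 70) +
  assumes nonempty: "S \<noteq> {}"
    and circ_add: "a \<in> S \<Longrightarrow> b \<in> S \<Longrightarrow> c \<in> S \<Longrightarrow>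
          a \<odot> (b \<oplus> c) = a \<odot> b \<oplus> inverse_on S (\<oplus>) a \<oplus> a \<odot> c"
    and circ_inverse: "a \<in> S \<Longrightarrow> a \<odot> inverse_on S (\<odot>) a = inverse_on S (\<oplus>) a \<oplus> a"

definition brace_lambda ::
    "'a set \<Rightarrow> ('a \<Rightarrow> 'a \<Rightarrow> 'a) \<Rightarrow> ('a \<Rightarrow> 'a \<Rightarrow> 'a) \<Rightarrow> 'a \<Rightarrow> 'a \<Rightarrow> 'a" where
  "brace_lambda S add circ a = (\<lambda>b\<in>S. circ a (add (inverse_on S circ a) b))"

end

theory Submission
  imports Defs
begin

text \<open>
  Since \<open>a \<circ> a\<^sup>- = -a + a\<close>, the distributive law turns \<open>\<lambda>\<^sub>a(b) = a \<circ> (a\<^sup>- + b)\<close> into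
  \<open>\<lambda>\<^sub>a(b) = -a + a \<circ> b\<close>. In this form additivity of \<open>\<lambda>\<^sub>a\<close> is the distributive law again,
  with \<open>-a\<close> added on the left.

  For multiplicativity, \<open>\<lambda>\<^sub>a\<close> preserves negatives because it is additive, and therefore
  \<open>\<lambda>\<^sub>a(\<lambda>\<^sub>b(c)) = -\<lambda>\<^sub>a(b) + \<lambda>\<^sub>a(b \<circ> c) = -(a \<circ> b) + (a - a) + a \<circ> b \<circ> c\<close>. This equals
  \<open>\<lambda>\<^bsub>a \<circ> b\<^esub>(c)\<close> as soon as \<open>a - a\<close> is a left identity for every \<open>a \<circ> x\<close>
  (lemma \<open>add_domain_circ\<close>).

  That absorption law is where the second inverse semigroup structure matters. The identity
  \<open>a \<circ> a\<^sup>- = -a + a\<close> forces both operations to have the same idempotents. Idempotents of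
  an inverse semigroup commute, and their products are idempotent, so for idempotents \<open>e\<close> and \<open>f\<close>
  the element \<open>e \<circ> f\<close> is additively idempotent, and
  \<open>e \<circ> f = e \<circ> (f + f) = e \<circ> f + e + e \<circ> f = e + e \<circ> f\<close>. Splitting off \<open>b - b\<close> from
  an arbitrary \<open>b\<close> extends this to \<open>e \<circ> b = e + e \<circ> b\<close>, and the choice
  \<open>e = a\<^sup>- \<circ> a\<close> gives the absorption law.
\<close>

section \<open>Inverse semigroups on a carrier set\<close>

context inverse_semigroup_on
begin

notation f (infixl "\<cdot>" 70)

abbreviation inv :: "'a \<Rightarrow> 'a"
  where "inv \<equiv> inverse_on S (\<cdot>)"

lemma is_inverse_inv: "a \<in> S \<Longrightarrow> is_inverse_on S (\<cdot>) a (inv a)"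
  unfolding inverse_on_def by (rule theI') (rule ex1_inverse)

lemma inv_closed: "a \<in> S \<Longrightarrow> inv a \<in> S"
  and mult_inv_mult: "a \<in> S \<Longrightarrow> a \<cdot> inv a \<cdot> a = a"
  and inv_mult_inv: "a \<in> S \<Longrightarrow> inv a \<cdot> a \<cdot> inv a = inv a"
  using is_inverse_inv unfolding is_inverse_on_def by auto

lemma inv_eqI:
  assumes "a \<in> S" "x \<in> S" "a \<cdot> x \<cdot> a = a" "x \<cdot> a \<cdot> x = x"
  shows "inv a = x"
  using ex1_inverse[OF assms(1)] is_inverse_inv[OF assms(1)] assms(2-)
  unfolding is_inverse_on_def by blast

lemma inv_inv: "a \<in> S \<Longrightarrow> inv (inv a) = a"
  by (rule inv_eqI) (auto simp: inv_closed mult_inv_mult inv_mult_inv)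

lemma inv_idempotent: "e \<in> S \<Longrightarrow> e \<cdot> e = e \<Longrightarrow> inv e = e"
  by (rule inv_eqI) auto

lemma mult_inv_idempotent: "a \<in> S \<Longrightarrow> a \<cdot> inv a \<cdot> (a \<cdot> inv a) = a \<cdot> inv a"
  by (metis assoc closed inv_closed mult_inv_mult)

lemma inv_mult_idempotent: "a \<in> S \<Longrightarrow> inv a \<cdot> a \<cdot> (inv a \<cdot> a) = inv a \<cdot> a"
  by (metis inv_closed inv_inv mult_inv_idempotent)

lemma idempotent_absorb_left: "e \<in> S \<Longrightarrow> e \<cdot> e = e \<Longrightarrow> x \<in> S \<Longrightarrow> e \<cdot> (e \<cdot> x) = e \<cdot> x"
  by (metis assoc)

text \<open>
  If \<open>x\<close> is the inverse of \<open>e \<cdot> f\<close>, then \<open>f \<cdot> x \<cdot> e\<close> is an idempotent that is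
  also inverse to \<open>e \<cdot> f\<close>. By uniqueness it is \<open>x\<close>, so \<open>e \<cdot> f\<close> is the inverse of an
  idempotent and hence that idempotent itself.
\<close>

lemma idempotent_mult:
  assumes e: "e \<in> S" "e \<cdot> e = e" and g: "g \<in> S" "g \<cdot> g = g"
  shows "e \<cdot> g \<cdot> (e \<cdot> g) = e \<cdot> g"
proof -
  define x where "x = inv (e \<cdot> g)"
  have x: "x \<in> S" unfolding x_def by (intro inv_closed closed e g)
  have xl: "e \<cdot> (g \<cdot> (x \<cdot> (e \<cdot> g))) = e \<cdot> g"
    using mult_inv_mult[of "e \<cdot> g"] e g x by (simp add: x_def[symmetric] assoc closed)
  have "x \<cdot> (e \<cdot> g) \<cdot> x = x"
    unfolding x_def by (intro inv_mult_inv closed e g)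
  then have xr: "x \<cdot> (e \<cdot> (g \<cdot> x)) = x"
    using e g x by (simp add: assoc closed)
  have xr': "x \<cdot> (e \<cdot> (g \<cdot> (x \<cdot> z))) = x \<cdot> z" if "z \<in> S" for z
    using arg_cong[OF xr, of "\<lambda>t. t \<cdot> z"] e g x that by (simp add: assoc closed)
  have "x = g \<cdot> x \<cdot> e"
    unfolding x_def
  proof (rule inv_eqI, fold x_def)
    show "e \<cdot> g \<cdot> (g \<cdot> x \<cdot> e) \<cdot> (e \<cdot> g) = e \<cdot> g"
      using e g x xl by (simp add: assoc closed idempotent_absorb_left)
    show "g \<cdot> x \<cdot> e \<cdot> (e \<cdot> g) \<cdot> (g \<cdot> x \<cdot> e) = g \<cdot> x \<cdot> e"
      using e g x xr' by (simp add: assoc closed idempotent_absorb_left)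
  qed (use e g x in \<open>auto intro: closed\<close>)
  moreover have "g \<cdot> x \<cdot> e \<cdot> (g \<cdot> x \<cdot> e) = g \<cdot> x \<cdot> e"
    using e g x xr' by (simp add: assoc closed)
  ultimately have "x \<cdot> x = x" by simp
  then have "inv x = x" using x by (simp add: inv_idempotent)
  moreover have "inv x = e \<cdot> g"
    unfolding x_def by (intro inv_inv closed e g)
  ultimately show ?thesis using \<open>x \<cdot> x = x\<close> by simp
qed

text \<open>
  Both products are idempotent, so \<open>g \<cdot> e\<close> is an inverse of \<open>e \<cdot> g\<close>, and so is \<open>e \<cdot> g\<close> itself.
\<close>

lemma idempotent_commute:
  assumes e: "e \<in> S" "e \<cdot> e = e" and g: "g \<in> S" "g \<cdot> g = g"
  shows "e \<cdot> g = g \<cdot> e"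
proof -
  have "e \<cdot> g = inv (e \<cdot> g)"
    by (rule inv_idempotent[symmetric]) (simp_all add: closed idempotent_mult e g)
  also have "\<dots> = g \<cdot> e"
    using idempotent_mult[OF e g] idempotent_mult[OF g e] e g
    by (intro inv_eqI) (auto simp: assoc closed idempotent_absorb_left)
  finally show ?thesis .
qed

lemma inv_mult:
  assumes a: "a \<in> S" and b: "b \<in> S"
  shows "inv (a \<cdot> b) = inv b \<cdot> inv a"
proof (rule inv_eqI)
  \<comment> \<open>Exchanging the idempotents \<open>b \<cdot> inv b\<close> and \<open>inv a \<cdot> a\<close> brings each factor next to its inverse.\<close>
  have comm: "b \<cdot> inv b \<cdot> (inv a \<cdot> a) = inv a \<cdot> a \<cdot> (b \<cdot> inv b)"
    by (intro idempotent_commute closed inv_closed mult_inv_idempotent inv_mult_idempotent a b)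
  have "a \<cdot> b \<cdot> (inv b \<cdot> inv a) \<cdot> (a \<cdot> b) = a \<cdot> (b \<cdot> inv b \<cdot> (inv a \<cdot> a)) \<cdot> b"
    using a b by (simp add: assoc closed inv_closed)
  also have "\<dots> = (a \<cdot> inv a \<cdot> a) \<cdot> (b \<cdot> inv b \<cdot> b)"
    unfolding comm using a b by (simp add: assoc closed inv_closed)
  finally show "a \<cdot> b \<cdot> (inv b \<cdot> inv a) \<cdot> (a \<cdot> b) = a \<cdot> b"
    using a b by (simp add: mult_inv_mult)
  have "inv b \<cdot> inv a \<cdot> (a \<cdot> b) \<cdot> (inv b \<cdot> inv a)
      = inv b \<cdot> (inv a \<cdot> a \<cdot> (b \<cdot> inv b)) \<cdot> inv a"
    using a b by (simp add: assoc closed inv_closed)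
  also have "\<dots> = (inv b \<cdot> b \<cdot> inv b) \<cdot> (inv a \<cdot> a \<cdot> inv a)"
    unfolding comm[symmetric] using a b by (simp add: assoc closed inv_closed)
  finally show "inv b \<cdot> inv a \<cdot> (a \<cdot> b) \<cdot> (inv b \<cdot> inv a) = inv b \<cdot> inv a"
    using a b by (simp add: inv_mult_inv)
qed (use a b in \<open>auto intro: closed inv_closed\<close>)

lemma endomorphism_inv:
  assumes h: "semigroup_hom_on S (\<cdot>) S (\<cdot>) h" and a: "a \<in> S"
  shows "h (inv a) = inv (h a)"
proof -
  interpret h: semigroup_hom_on S "(\<cdot>)" S "(\<cdot>)" h by (rule h)
  have S: "h x \<in> S" if "x \<in> S" for x using h.maps_to that by auto
  show ?thesis
    using a by (intro inv_eqI[symmetric])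
      (simp_all add: S inv_closed closed h.hom[symmetric] mult_inv_mult inv_mult_inv)
qed

end

section \<open>The endomorphism semigroup\<close>

lemma (in semigroup_on) semigroup_endomorphisms_on:
  "semigroup_on (endomorphisms_on S f) (compose S)"
proof
  fix h k
  assume h: "h \<in> endomorphisms_on S f" and k: "k \<in> endomorphisms_on S f"
  interpret h: semigroup_hom_on S f S f h using h by (simp add: endomorphisms_on_def)
  interpret k: semigroup_hom_on S f S f k using k by (simp add: endomorphisms_on_def)
  have "semigroup_hom_on S f S f (compose S h k)"
    using h.maps_to k.maps_to
    by unfold_locales (auto simp: compose_def h.hom k.hom closed Pi_iff)
  moreover have "compose S h k \<in> S \<rightarrow>\<^sub>E S"
    using h.maps_to k.maps_to by (auto simp: compose_def)
  ultimately show "compose S h k \<in> endomorphisms_on S f"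
    by (simp add: endomorphisms_on_def)
next
  fix h k l
  assume "h \<in> endomorphisms_on S f" "k \<in> endomorphisms_on S f" "l \<in> endomorphisms_on S f"
  then show "compose S (compose S h k) l = compose S h (compose S k l)"
    by (auto simp: endomorphisms_on_def compose_def fun_eq_iff)
qed

section \<open>Idempotents of a weak brace\<close>

context weak_brace
begin

abbreviation neg :: "'a \<Rightarrow> 'a" ("\<ominus> _" [81] 80)
  where "\<ominus> a \<equiv> inverse_on S (\<oplus>) a"

abbreviation lam :: "'a \<Rightarrow> 'a \<Rightarrow> 'a"
  where "lam \<equiv> brace_lambda S (\<oplus>) (\<odot>)"

text \<open>
  An idempotent \<open>e\<close> of either operation is its own inverse for that operation, so one side of
  \<open>e \<circ> e\<^sup>- = -e + e\<close> is \<open>e\<close>, while the other side is idempotent for the other operation.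
\<close>

lemma circ_idempotent_iff_add_idempotent:
  assumes e: "e \<in> S"
  shows "e \<odot> e = e \<longleftrightarrow> e \<oplus> e = e"
proof
  assume "e \<odot> e = e"
  then have "\<ominus> e \<oplus> e = e"
    using circ_inverse[OF e] circ.inv_idempotent[OF e] by simp
  then show "e \<oplus> e = e" using add.inv_mult_idempotent[OF e] by simp
next
  assume "e \<oplus> e = e"
  then have "e \<odot> circ.inv e = e"
    using circ_inverse[OF e] add.inv_idempotent[OF e] by simp
  then show "e \<odot> e = e" using circ.mult_inv_idempotent[OF e] by simp
qed

lemma add_idempotent_circ:
  assumes e: "e \<in> S" "e \<oplus> e = e" and b: "b \<in> S"
  shows "e \<oplus> e \<odot> b = e \<odot> b"
proof -
  define g where "g = b \<oplus> \<ominus> b"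
  have g: "g \<in> S" "g \<oplus> g = g"
    unfolding g_def by (auto simp: b add.closed add.inv_closed add.mult_inv_idempotent)
  have gb: "g \<oplus> b = b" unfolding g_def by (rule add.mult_inv_mult[OF b])
  have neg_e: "\<ominus> e = e" using e by (rule add.inv_idempotent)
  have eg: "e \<odot> g \<in> S" using e g by (simp add: circ.closed)
  have eb: "e \<odot> b \<in> S" using e b by (simp add: circ.closed)
  have "e \<odot> g \<odot> (e \<odot> g) = e \<odot> g"
    using e g by (intro circ.idempotent_mult) (auto simp: circ_idempotent_iff_add_idempotent)
  then have eg_idem: "e \<odot> g \<oplus> e \<odot> g = e \<odot> g"
    using circ_idempotent_iff_add_idempotent[OF eg] by simp
  have comm: "e \<odot> g \<oplus> e = e \<oplus> e \<odot> g"
    by (intro add.idempotent_commute eg eg_idem e)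
  have "e \<odot> g = e \<odot> g \<oplus> e \<oplus> e \<odot> g"
    using circ_add[OF e(1) g(1) g(1)] by (simp add: g neg_e)
  also have "\<dots> = e \<oplus> e \<odot> g"
    unfolding comm using e eg eg_idem by (simp add: add.assoc)
  finally have e_eg: "e \<oplus> e \<odot> g = e \<odot> g" by simp
  have "e \<odot> b = e \<odot> g \<oplus> e \<oplus> e \<odot> b"
    using circ_add[OF e(1) g(1) b] by (simp add: gb neg_e)
  then have split: "e \<odot> b = e \<odot> g \<oplus> e \<odot> b"
    by (simp add: comm e_eg)
  have "e \<oplus> e \<odot> b = e \<oplus> e \<odot> g \<oplus> e \<odot> b"
    using e eg eb by (subst split) (simp add: add.assoc)
  then show ?thesis using e_eg split by simp
qed

text \<open>
  The previous lemma applies to \<open>e = a\<^sup>- \<circ> a\<close>, and \<open>a \<circ> e = a\<close>: multiplying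
  \<open>e \<circ> b = e + e \<circ> b\<close> by \<open>a\<close> and distributing turns the summand \<open>e\<close> into \<open>a - a\<close>.
\<close>

lemma add_domain_circ:
  assumes a: "a \<in> S" and b: "b \<in> S"
  shows "a \<oplus> \<ominus> a \<oplus> a \<odot> b = a \<odot> b"
proof -
  define e where "e = circ.inv a \<odot> a"
  have e: "e \<in> S" unfolding e_def by (intro circ.closed circ.inv_closed a)
  have "e \<odot> e = e" unfolding e_def by (rule circ.inv_mult_idempotent[OF a])
  then have "e \<oplus> e = e" using circ_idempotent_iff_add_idempotent[OF e] by simp
  then have absorb: "e \<oplus> e \<odot> b = e \<odot> b" using e b by (intro add_idempotent_circ)
  have ae: "a \<odot> e = a"
    unfolding e_def using a by (simp add: circ.assoc[symmetric] circ.inv_closed circ.mult_inv_mult)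
  have aeb: "a \<odot> (e \<odot> b) = a \<odot> b"
    using ae a e b by (simp add: circ.assoc[symmetric])
  have "a \<odot> (e \<oplus> e \<odot> b) = a \<oplus> \<ominus> a \<oplus> a \<odot> b"
    using circ_add[OF a e circ.closed[OF e b]] ae aeb by simp
  then show ?thesis using absorb aeb by simp
qed

section \<open>The map \<open>\<lambda>\<close>\<close>

lemma brace_lambda_eq:
  assumes a: "a \<in> S" and b: "b \<in> S"
  shows "lam a b = \<ominus> a \<oplus> a \<odot> b"
proof -
  have "lam a b = a \<odot> circ.inv a \<oplus> \<ominus> a \<oplus> a \<odot> b"
    using a b circ_add[of a "circ.inv a" b] by (simp add: brace_lambda_def circ.inv_closed)
  also have "\<dots> = \<ominus> a \<oplus> a \<odot> b"
    using a by (simp add: circ_inverse add.inv_mult_inv)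
  finally show ?thesis .
qed

lemma brace_lambda_closed: "a \<in> S \<Longrightarrow> b \<in> S \<Longrightarrow> lam a b \<in> S"
  by (simp add: brace_lambda_eq add.closed add.inv_closed circ.closed)

lemma brace_lambda_hom:
  assumes a: "a \<in> S"
  shows "semigroup_hom_on S (\<oplus>) S (\<oplus>) (lam a)"
proof
  show "lam a \<in> S \<rightarrow> S" using a by (auto intro: brace_lambda_closed)
next
  fix b c assume "b \<in> S" "c \<in> S"
  then show "lam a (b \<oplus> c) = lam a b \<oplus> lam a c"
    using a by (simp add: brace_lambda_eq circ_add add.assoc add.closed circ.closed add.inv_closed)
qed

lemma brace_lambda_endomorphism: "a \<in> S \<Longrightarrow> lam a \<in> endomorphisms_on S (\<oplus>)"
  using brace_lambda_hom brace_lambda_closed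
  by (auto simp: endomorphisms_on_def brace_lambda_def)

lemma brace_lambda_circ:
  assumes a: "a \<in> S" and b: "b \<in> S" and c: "c \<in> S"
  shows "lam (a \<odot> b) c = lam a (lam b c)"
proof -
  interpret lam_a: semigroup_hom_on S "(\<oplus>)" S "(\<oplus>)" "lam a"
    by (rule brace_lambda_hom[OF a])
  have ab: "a \<odot> b \<in> S" and bc: "b \<odot> c \<in> S" and abc: "a \<odot> (b \<odot> c) \<in> S"
    using a b c by (auto intro: circ.closed)
  have "\<ominus> (lam a b) = \<ominus> (a \<odot> b) \<oplus> a"
    using a b ab by (simp add: brace_lambda_eq add.inv_mult add.inv_inv add.inv_closed)
  moreover have "lam a (\<ominus> b) = \<ominus> (lam a b)"
    by (rule add.endomorphism_inv[OF brace_lambda_hom[OF a] b])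
  ultimately have "lam a (lam b c) = \<ominus> (a \<odot> b) \<oplus> a \<oplus> (\<ominus> a \<oplus> a \<odot> (b \<odot> c))"
    using a b c bc by (simp add: brace_lambda_eq[of b c] lam_a.hom add.inv_closed
        brace_lambda_eq[of a "b \<odot> c"])
  also have "\<dots> = \<ominus> (a \<odot> b) \<oplus> (a \<oplus> \<ominus> a \<oplus> a \<odot> (b \<odot> c))"
    using a ab abc by (simp add: add.assoc add.closed add.inv_closed)
  also have "\<dots> = lam (a \<odot> b) c"
    using a b c ab bc by (simp add: add_domain_circ brace_lambda_eq circ.assoc)
  finally show ?thesis by simp
qed

lemma brace_lambda_circ_compose:
  "a \<in> S \<Longrightarrow> b \<in> S \<Longrightarrow> lam (a \<odot> b) = compose S (lam a) (lam b)"
  using brace_lambda_circ[of a b]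
  by (auto simp: fun_eq_iff compose_def brace_lambda_def restrict_def)

end

theorem proposition8:
  fixes S :: "'a set"
    and add :: "'a \<Rightarrow> 'a \<Rightarrow> 'a"
    and circ :: "'a \<Rightarrow> 'a \<Rightarrow> 'a"
  assumes "weak_brace S add circ"
  shows "(\<forall>a\<in>S. semigroup_hom_on S add S add (brace_lambda S add circ a))
    \<and> semigroup_hom_on S circ (endomorphisms_on S add) (compose S) (brace_lambda S add circ)
    \<and> (\<forall>a\<in>S. \<forall>b\<in>S. brace_lambda S add circ (circ a b)
          = compose S (brace_lambda S add circ a) (brace_lambda S add circ b))"
proof -
  interpret weak_brace S add circ by (rule assms)
  interpret End: semigroup_on "endomorphisms_on S add" "compose S"
    by (rule add.semigroup_endomorphisms_on)
  have "semigroup_hom_on S circ (endomorphisms_on S add) (compose S) (brace_lambda S add circ)"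
    by unfold_locales (auto simp: brace_lambda_endomorphism brace_lambda_circ_compose)
  then show ?thesis
    by (simp add: brace_lambda_hom brace_lambda_circ_compose)
qed

end
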